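(* There exist $\varepsilon>0$ and a non-constant real analytic map $\Phi:[0,\varepsilon)\to\mathbb{R}^{3\times12}$ such that $\Phi(t)$ is the coordinate matrix of a $\langle d\rangle$-invariant icosahedron for all but finitely many $t\in[0,\varepsilon)$. In particular, there exist infinitely many isometry types of $\langle d\rangle$-invariant icosahedra.
   Context: Let $a,b,c,d$ be the permutations of $\{1,\dots,12\}$ $a=(1,2)(3,4)(5,7)(6,8)(9,11)(10,12)$, $b=(1,10)(3,9)(2,12)(4,11)(5,6)(7,8)$, $c=(1,7)(2,3)(4,11)(5,12)(6,8)(9,10)$, $d=(1,12)(3,9)(2,10)(4,11)(5,7)(6,8)$. The group $A=\langle a,b,c,d\rangle\cong C_2\times A_5$ of order 120 is the combinatorial automorphism group of the abstract icosahedron with vertex set $\{1,\dots,12\}$; $d$ generates its center. The 30 edges are the sets in the $A$-orbit of $\{1,2\}$. An icosahedron is a tuple of pairwise distinct points $V_1,\dots,V_{12}\in\mathbb{R}^3$ with $\|V_i-V_j\|=1$ for each edge $\{i,j\}$ and $V_1+\dots+V_{12}=0$. Its coordinate matrix is $M=(V_1,\dots,V_{12})\in\mathbb{R}^{3\times 12}$ and its Gram-matrix is $G=M^{tr}M$. For $g\in A$ let $\pi(g)$ be the permutation matrix with $\pi(g)e_i=e_{g(i)}$; $A$ acts on Gram-matrices of icosahedra by $G\mapsto\pi(g)^{tr}G\pi(g)$. Two icosahedra have the same isometry type if their Gram-matrices lie in the same $A$-orbit. An icosahedron is $\langle d\rangle$-invariant if its Gram-matrix satisfies $\pi(d)^{tr}G\pi(d)=G$.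 *)

theory Defs
  imports
    "HOL-Analysis.Analysis"
    "HOL-Algebra.Bij"
    "HOL-Algebra.Generated_Groups"
    "HOL-Combinatorics.Transposition"
begin

text \<open>
  The label set \<open>{1,\<dots>,12}\<close> is the numeral type \<open>12\<close> (residues modulo 12): the numerals
  \<open>1, \<dots>, 12\<close> denote its twelve distinct elements, with \<open>12 = 0\<close>.
\<close>

definition perm_a :: "12 \<Rightarrow> 12" where
  "perm_a = Transposition.transpose 1 2 \<circ> Transposition.transpose 3 4 \<circ>
    Transposition.transpose 5 7 \<circ> Transposition.transpose 6 8 \<circ>
    Transposition.transpose 9 11 \<circ> Transposition.transpose 10 12"

definition perm_b :: "12 \<Rightarrow> 12" where
  "perm_b = Transposition.transpose 1 10 \<circ> Transposition.transpose 3 9 \<circ>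
    Transposition.transpose 2 12 \<circ> Transposition.transpose 4 11 \<circ>
    Transposition.transpose 5 6 \<circ> Transposition.transpose 7 8"

definition perm_c :: "12 \<Rightarrow> 12" where
  "perm_c = Transposition.transpose 1 7 \<circ> Transposition.transpose 2 3 \<circ>
    Transposition.transpose 4 11 \<circ> Transposition.transpose 5 12 \<circ>
    Transposition.transpose 6 8 \<circ> Transposition.transpose 9 10"

definition perm_d :: "12 \<Rightarrow> 12" where
  "perm_d = Transposition.transpose 1 12 \<circ> Transposition.transpose 3 9 \<circ>
    Transposition.transpose 2 10 \<circ> Transposition.transpose 4 11 \<circ>
    Transposition.transpose 5 7 \<circ> Transposition.transpose 6 8"

definition icosahedral_group :: "(12 \<Rightarrow> 12) set" where
  "icosahedral_group = generate (BijGroup UNIV) {perm_a, perm_b, perm_c, perm_d}"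

definition edges :: "12 set set" where
  "edges = (\<lambda>g. g ` {1, 2}) ` icosahedral_group"

text \<open>A matrix \<open>M :: real^12^3\<close> has 3 rows and 12 columns; column \<open>i\<close> is the vertex \<open>V\<^sub>i\<close>.\<close>

definition is_icosahedron :: "real^12^3 \<Rightarrow> bool" where
  "is_icosahedron M \<longleftrightarrow>
    inj (\<lambda>i. column i M) \<and>
    (\<forall>i j. {i, j} \<in> edges \<longrightarrow> norm (column i M - column j M) = 1) \<and>
    (\<Sum>i\<in>UNIV. column i M) = 0"

definition gram :: "real^12^3 \<Rightarrow> real^12^12" where
  "gram M = Finite_Cartesian_Product.transpose M ** M"

text \<open>Column \<open>j\<close> of \<open>perm_matrix g\<close> is the unit vector with index \<open>g j\<close>.\<close>

definition perm_matrix :: "(12 \<Rightarrow> 12) \<Rightarrow> real^12^12" where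
  "perm_matrix g = (\<chi> i j. if i = g j then 1 else 0)"

definition gram_action :: "(12 \<Rightarrow> 12) \<Rightarrow> real^12^12 \<Rightarrow> real^12^12" where
  "gram_action g G = Finite_Cartesian_Product.transpose (perm_matrix g) ** G ** perm_matrix g"

text \<open>
  The isometry type of an icosahedron is represented by the orbit of its Gram matrix, so that
  two icosahedra have the same isometry type iff their \<open>isometry_type\<close>s are equal.
\<close>

definition isometry_type :: "real^12^3 \<Rightarrow> (real^12^12) set" where
  "isometry_type M = (\<lambda>g. gram_action g (gram M)) ` icosahedral_group"

definition d_invariant_icosahedron :: "real^12^3 \<Rightarrow> bool" where
  "d_invariant_icosahedron M \<longleftrightarrow>
    is_icosahedron M \<and> gram_action perm_d (gram M) = gram M"

text \<open>
  The expansion at \<open>x\<close> is only required to represent \<open>f\<close> on \<open>S\<close> near \<open>x\<close>, so \<open>S\<close> need not be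
  open. At the left end point of \<open>[0, \<epsilon>)\<close> this agrees with the existence of an analytic
  extension to a neighbourhood: a power series converging on \<open>[0, r)\<close> converges on \<open>(-r, r)\<close>.
\<close>

definition real_analytic_on :: "(real \<Rightarrow> 'a::real_normed_vector) \<Rightarrow> real set \<Rightarrow> bool" where
  "real_analytic_on f S \<longleftrightarrow>
    (\<forall>x\<in>S. \<exists>r>0. \<exists>c :: nat \<Rightarrow> 'a. \<forall>y\<in>S. \<bar>y - x\<bar> < r \<longrightarrow>
      (\<lambda>n. (y - x) ^ n *\<^sub>R c n) sums f y)"

end

theory Submission
  imports Defs "HOL-Complex_Analysis.Cauchy_Integral_Formula"
begin

text \<open>
  Realise \<open>d\<close> by the half-turn about the third coordinate axis. A configuration is then given by
  the vertices \<open>1, \<dots>, 6\<close>, one from each orbit of \<open>d\<close>, and must satisfy 15 quadratic equations, one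
  for each orbit of edges, in 18 unknowns; rotation about and translation along the axis use up two
  of the three remaining dimensions. There is a degenerate solution, with vertices 5 and 8 as well as
  6 and 7 coinciding, whose coordinates lie in the field generated by the square roots of 2 and 23,
  in which the tetrahedra on \<open>1, 2, 3, 6\<close>, on \<open>1, 2, 6, 5\<close> and on \<open>1, 2, 5, 4\<close> are regular. It carries no
  self-stress, so the derivative of the equations is onto, and every first-order flex extends to a
  power series solution. The chosen flex separates 5 from 8 and 6 from 7, so all vertices are
  distinct for small positive times. The distance between vertices 5 and 8 is then positive but
  tends to 0, so it takes infinitely many values, while an isometry type has only finitely many
  Gram matrices.
\<close>

subsection \<open>Power series curves on quadrics\<close>

text \<open>The map \<open>s \<mapsto> a 1 + K * s\<^sup>2\<close> sends \<open>[0, 2 * a 1]\<close> into itself, which bounds the partial sums.\<close>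

lemma quadratic_recursion_bound:
  fixes a :: "nat \<Rightarrow> real"
  assumes nonneg: "\<And>n. 0 \<le> a n" and zero: "a 0 = 0" and K: "0 \<le> K"
    and rec: "\<And>n. 2 \<le> n \<Longrightarrow> a n \<le> K * (\<Sum>k\<le>n. a k * a (n - k))"
    and small: "4 * K * a 1 \<le> 1"
  shows "(\<Sum>n\<le>N. a n) \<le> 2 * a 1"
proof (induction N)
  case 0
  then show ?case using nonneg[of 1] zero by simp
next
  case (Suc N)
  let ?T = "{(i, j). i + j \<le> Suc N}" and ?f = "\<lambda>(i, j). a i * a j"
  have finT: "finite ?T"
    by (rule finite_subset[of _ "{..Suc N} \<times> {..Suc N}"]) auto
  have "(\<Sum>n=2..Suc N. a n) \<le> (\<Sum>n=2..Suc N. K * (\<Sum>k\<le>n. a k * a (n - k)))"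
    by (intro sum_mono rec) auto
  also have "\<dots> \<le> (\<Sum>n\<le>Suc N. K * (\<Sum>k\<le>n. a k * a (n - k)))"
    by (intro sum_mono2 mult_nonneg_nonneg sum_nonneg K nonneg) auto
  also have "\<dots> = K * sum ?f ?T"
    by (simp only: sum.triangle_reindex_eq sum_distrib_left)
  also have "\<dots> \<le> K * sum ?f ({..N} \<times> {..N})"
  proof (intro mult_left_mono K)
    \<comment> \<open>As \<open>a 0 = 0\<close>, only pairs of positive indices count; if their sum
      is at most \<open>Suc N\<close>, both are at most \<open>N\<close>, so the induction
      hypothesis covers them.\<close>
    have "sum ?f ?T = sum ?f (?T \<inter> {..N} \<times> {..N})"
    proof (intro sum.mono_neutral_right finT)
      show "\<forall>p\<in>?T - ?T \<inter> {..N} \<times> {..N}. ?f p = 0"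
      proof
        fix p assume "p \<in> ?T - ?T \<inter> {..N} \<times> {..N}"
        then obtain i j where "p = (i, j)" "i = 0 \<or> j = 0"
          by (cases p) force
        then show "?f p = 0" using zero by auto
      qed
    qed auto
    also have "\<dots> \<le> sum ?f ({..N} \<times> {..N})"
      using nonneg by (intro sum_mono2) auto
    finally show "sum ?f ?T \<le> sum ?f ({..N} \<times> {..N})" .
  qed
  also have "sum ?f ({..N} \<times> {..N}) = (\<Sum>n\<le>N. a n)\<^sup>2"
    by (simp add: power2_eq_square sum_product sum.cartesian_product)
  also have "K * (\<Sum>n\<le>N. a n)\<^sup>2 \<le> K * (2 * a 1)\<^sup>2"
    using Suc nonneg by (intro mult_left_mono power_mono sum_nonneg K) auto
  also have "\<dots> = (4 * K * a 1) * a 1"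
    by (simp add: power2_eq_square)
  also have "\<dots> \<le> 1 * a 1"
    by (intro mult_right_mono small nonneg)
  finally have "(\<Sum>n=2..Suc N. a n) \<le> a 1" by simp
  moreover have "(\<Sum>n\<le>Suc N. a n) = a 0 + a 1 + (\<Sum>n=2..Suc N. a n)"
  proof -
    have "{..Suc N} = insert 0 (insert 1 {2..Suc N})" by auto
    then show ?thesis by simp
  qed
  ultimately show ?case using zero by simp
qed

text \<open>Sums over squares converge to the right-hand side by continuity of \<open>B\<close>.
  Sums over triangles differ from them by at most \<open>K\<close> times the same difference for the
  norms, which tends to 0 by the scalar Cauchy product.\<close>

lemma bilinear_Cauchy_product:
  fixes B :: "'a::banach \<Rightarrow> 'b::banach \<Rightarrow> 'c::real_normed_vector"
  assumes "bounded_bilinear B"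
    and x: "summable (\<lambda>n. norm (x n))" and y: "summable (\<lambda>n. norm (y n))"
  shows "(\<lambda>n. \<Sum>k\<le>n. B (x k) (y (n - k))) sums B (\<Sum>n. x n) (\<Sum>n. y n)"
proof -
  interpret B: bounded_bilinear B by fact
  obtain K where K: "\<And>a b. norm (B a b) \<le> norm a * norm b * K"
    using B.bounded by blast
  let ?T = "\<lambda>N::nat. {(i, j). i + j < N}" and ?Q = "\<lambda>N::nat. {..<N} \<times> {..<N}"
  let ?p = "\<lambda>(i, j). B (x i) (y j)" and ?q = "\<lambda>(i, j). norm (x i) * norm (y j)"
  have sub: "?T N \<subseteq> ?Q N" for N by auto
  have "(\<lambda>N. sum ?q (?Q N)) \<longlonglongrightarrow> (\<Sum>n. norm (x n)) * (\<Sum>n. norm (y n))"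
    using tendsto_mult[OF summable_LIMSEQ[OF x] summable_LIMSEQ[OF y]]
    by (simp add: sum_product sum.cartesian_product)
  moreover have "(\<lambda>N. sum ?q (?T N)) \<longlonglongrightarrow> (\<Sum>n. norm (x n)) * (\<Sum>n. norm (y n))"
    using Cauchy_product_sums[of "\<lambda>n. norm (x n)" "\<lambda>n. norm (y n)"] x y
    unfolding sums_def sum.triangle_reindex by simp
  ultimately have "(\<lambda>N. K * (sum ?q (?Q N) - sum ?q (?T N))) \<longlonglongrightarrow> 0"
    by (auto intro!: tendsto_eq_intros)
  then have "(\<lambda>N. sum ?p (?Q N) - sum ?p (?T N)) \<longlonglongrightarrow> 0"
  proof (rule Lim_null_comparison[rotated], intro always_eventually allI)
    fix N
    have "norm (sum ?p (?Q N) - sum ?p (?T N)) = norm (sum ?p (?Q N - ?T N))"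
      using sub by (simp add: sum_diff)
    also have "\<dots> \<le> (\<Sum>p\<in>?Q N - ?T N. K * ?q p)"
      using K by (intro sum_norm_le) (auto simp: mult_ac)
    also have "\<dots> = K * (sum ?q (?Q N) - sum ?q (?T N))"
      using sub by (simp add: sum_diff sum_distrib_left[symmetric])
    finally show "norm (sum ?p (?Q N) - sum ?p (?T N)) \<le> K * (sum ?q (?Q N) - sum ?q (?T N))" .
  qed
  moreover have "(\<lambda>N. sum ?p (?Q N)) \<longlonglongrightarrow> B (\<Sum>n. x n) (\<Sum>n. y n)"
  proof -
    have "sum ?p (?Q N) = B (\<Sum>n<N. x n) (\<Sum>n<N. y n)" for N
      by (simp add: B.sum_left B.sum_right sum.cartesian_product[symmetric]) (rule sum.swap)
    then show ?thesis
      using B.tendsto[OF x[THEN summable_norm_cancel, THEN summable_LIMSEQ]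
          y[THEN summable_norm_cancel, THEN summable_LIMSEQ]] by simp
  qed
  ultimately have "(\<lambda>N. sum ?p (?T N)) \<longlonglongrightarrow> B (\<Sum>n. x n) (\<Sum>n. y n)"
    by (rule Lim_transform2[rotated])
  then show ?thesis
    by (simp add: sums_def sum.triangle_reindex)
qed

text \<open>
  Comparing coefficients of \<open>t\<^sup>n\<close> in \<open>B (f t) (f t) = B x x\<close> determines \<open>B x (c n)\<close> from the
  earlier coefficients; \<open>h\<close> will be a right inverse of \<open>B x\<close>.
\<close>

fun curve_coeff :: "('a \<Rightarrow> 'a \<Rightarrow> 'b::comm_monoid_add) \<Rightarrow> ('b \<Rightarrow> 'a) \<Rightarrow> 'a \<Rightarrow> 'a \<Rightarrow> nat \<Rightarrow> 'a::real_vector"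
  where "curve_coeff B h x v n =
    (if n = 0 then x else if n = 1 then v
     else - (1/2) *\<^sub>R h (\<Sum>k\<in>{1..<n}. B (curve_coeff B h x v k) (curve_coeff B h x v (n - k))))"

declare curve_coeff.simps [simp del]

lemma sum_atMost_split_ends:
  fixes f :: "nat \<Rightarrow> 'a::comm_monoid_add"
  assumes "0 < n"
  shows "(\<Sum>k\<le>n. f k) = f 0 + f n + (\<Sum>k\<in>{1..<n}. f k)"
proof -
  have "{..n} = insert 0 (insert n {1..<n})" using assms by auto
  then show ?thesis using assms by (simp add: add.assoc)
qed

lemma summable_norm_power_series:
  fixes c :: "nat \<Rightarrow> 'a::real_normed_vector"
  assumes "summable (\<lambda>n. norm (c n) * \<rho> ^ n)" and "\<bar>t\<bar> \<le> \<rho>"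
  shows "summable (\<lambda>n. norm (t ^ n *\<^sub>R c n))"
proof (rule summable_comparison_test[OF _ assms(1)], intro exI allI impI)
  fix n
  have "norm (norm (t ^ n *\<^sub>R c n)) = norm (c n) * \<bar>t\<bar> ^ n"
    by (simp add: power_abs mult.commute)
  also have "\<dots> \<le> norm (c n) * \<rho> ^ n"
    using assms(2) by (intro mult_left_mono power_mono) auto
  finally show "norm (norm (t ^ n *\<^sub>R c n)) \<le> norm (c n) * \<rho> ^ n" .
qed

text \<open>An analytic implicit function theorem for quadratic maps: \<open>curve_coeff\<close>
  extends \<open>v\<close> to a formal solution, \<open>quadratic_recursion_bound\<close> makes it
  converge absolutely, and the Cauchy product turns the formal identity into an actual one.\<close>

lemma quadric_curve:
  fixes B :: "'a::banach \<Rightarrow> 'a \<Rightarrow> 'b::banach"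
  assumes B: "bounded_bilinear B" and sym: "\<And>y z. B y z = B z y"
    and h: "bounded_linear h" and right_inverse: "\<And>y. B x (h y) = y"
    and v: "B x v = 0"
  obtains c \<rho> where "0 < \<rho>" "c 0 = x" "c 1 = v" "summable (\<lambda>n. norm (c n) * \<rho> ^ n)"
    "\<forall>t. \<bar>t\<bar> \<le> \<rho> \<longrightarrow> B (\<Sum>n. t ^ n *\<^sub>R c n) (\<Sum>n. t ^ n *\<^sub>R c n) = B x x"
proof -
  interpret B: bounded_bilinear B by fact
  obtain KB where KB: "0 \<le> KB" "\<And>a b. norm (B a b) \<le> norm a * norm b * KB"
    using B.nonneg_bounded by blast
  obtain Kh where Kh: "0 \<le> Kh" "\<And>a. norm (h a) \<le> norm a * Kh"
    using bounded_linear.nonneg_bounded[OF h] by blast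
  \<comment> \<open>\<open>K\<close> collects the bounds of \<open>h\<close> and \<open>B\<close>
    and the factor 1/2 of the recursion; \<open>\<rho>\<close> is chosen so that
    \<open>4 * K * a 1 \<le> 1\<close>.\<close>
  define K where "K = Kh * KB / 2"
  define \<rho> where "\<rho> = 1 / (4 * K * norm v + 1)"
  define c where "c = curve_coeff B h x v"
  \<comment> \<open>The constant term is replaced by 0, as the majorant bound requires. The
    recursion uses only indices strictly between 0 and \<open>n\<close>, so it is
    unaffected.\<close>
  define a where "a n = (if n = 0 then 0 else norm (c n) * \<rho> ^ n)" for n
  have K: "0 \<le> K" using KB Kh by (simp add: K_def)
  then have rho: "0 < \<rho>" by (simp add: \<rho>_def add_nonneg_pos)
  have c0: "c 0 = x" and c1: "c 1 = v"
    unfolding c_def by (subst curve_coeff.simps, simp)+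
  have c1': "c (Suc 0) = v" using c1 by simp
  have cn: "c n = - (1/2) *\<^sub>R h (\<Sum>k\<in>{1..<n}. B (c k) (c (n - k)))" if "2 \<le> n" for n
    using that unfolding c_def by (subst curve_coeff.simps) simp
  have bound: "(\<Sum>n\<le>N. a n) \<le> 2 * a 1" for N
  proof (rule quadratic_recursion_bound[where K = K])
    show "0 \<le> a n" for n using rho by (simp add: a_def)
    show "a 0 = 0" by (simp add: a_def)
    show "4 * K * a 1 \<le> 1" using K by (simp add: a_def c1' \<rho>_def divide_le_eq add_nonneg_pos)
    fix n :: nat assume n: "2 \<le> n"
    have "norm (c n) = norm (h (\<Sum>k\<in>{1..<n}. B (c k) (c (n - k)))) / 2"
      by (simp add: cn[OF n])
    also have "\<dots> \<le> norm (\<Sum>k\<in>{1..<n}. B (c k) (c (n - k))) * Kh / 2"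
      using Kh by (simp add: divide_right_mono)
    also have "\<dots> \<le> (\<Sum>k\<in>{1..<n}. norm (c k) * norm (c (n - k)) * KB) * Kh / 2"
      using Kh KB by (intro divide_right_mono mult_right_mono sum_norm_le) auto
    also have "\<dots> = K * (\<Sum>k\<in>{1..<n}. norm (c k) * norm (c (n - k)))"
      by (simp add: K_def sum_distrib_left sum_distrib_right sum_divide_distrib mult_ac)
    finally have "norm (c n) * \<rho> ^ n \<le> K * (\<Sum>k\<in>{1..<n}. norm (c k) * norm (c (n - k))) * \<rho> ^ n"
      using rho by (intro mult_right_mono) auto
    also have "\<dots> = K * (\<Sum>k\<in>{1..<n}. a k * a (n - k))"
    proof -
      have "norm (c k) * norm (c (n - k)) * \<rho> ^ n = a k * a (n - k)" if "k \<in> {1..<n}" for k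
        using that by (simp add: a_def power_add[symmetric] mult_ac)
      then show ?thesis by (simp add: sum_distrib_right mult.assoc)
    qed
    also have "(\<Sum>k\<in>{1..<n}. a k * a (n - k)) = (\<Sum>k\<le>n. a k * a (n - k))"
      using n by (subst sum_atMost_split_ends) (auto simp: a_def)
    finally show "a n \<le> K * (\<Sum>k\<le>n. a k * a (n - k))"
      using n by (simp add: a_def)
  qed (rule K)
  have "summable a"
    by (rule bounded_imp_summable[OF _ bound]) (use rho in \<open>simp add: a_def\<close>)
  then have sum: "summable (\<lambda>n. norm (c n) * \<rho> ^ n)"
    by (rule summable_cong[THEN iffD1, rotated])
      (auto simp: a_def eventually_sequentially intro!: exI[of _ 1])
  have "B (\<Sum>n. t ^ n *\<^sub>R c n) (\<Sum>n. t ^ n *\<^sub>R c n) = B x x" if t: "\<bar>t\<bar> \<le> \<rho>" for t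
  proof -
    have "summable (\<lambda>n. norm (t ^ n *\<^sub>R c n))"
      by (rule summable_norm_power_series[OF sum t])
    from bilinear_Cauchy_product[OF B this this]
    have "(\<lambda>n. \<Sum>k\<le>n. B (t ^ k *\<^sub>R c k) (t ^ (n - k) *\<^sub>R c (n - k))) sums
        B (\<Sum>n. t ^ n *\<^sub>R c n) (\<Sum>n. t ^ n *\<^sub>R c n)" .
    moreover have "(\<Sum>k\<le>n. B (t ^ k *\<^sub>R c k) (t ^ (n - k) *\<^sub>R c (n - k))) =
        (if n = 0 then B x x else 0)" for n
    proof -
      have "(\<Sum>k\<le>n. B (t ^ k *\<^sub>R c k) (t ^ (n - k) *\<^sub>R c (n - k))) =
          t ^ n *\<^sub>R (\<Sum>k\<le>n. B (c k) (c (n - k)))"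
        by (simp add: B.scaleR_left B.scaleR_right scaleR_sum_right power_add[symmetric])
      \<comment> \<open>For \<open>n = 1\<close> this is twice \<open>B x v\<close>. For larger
        \<open>n\<close> the two end terms add up to twice \<open>B x (c n)\<close>, the negative of
        the inner sum by the choice of \<open>c n\<close>.\<close>
      moreover have "(\<Sum>k\<le>n. B (c k) (c (n - k))) = 0" if "1 \<le> n"
      proof (cases "n = 1")
        case True
        then show ?thesis using v sym c0 c1 by simp
      next
        case False
        with that have n: "2 \<le> n" by simp
        have "B x (c n) = - (1/2) *\<^sub>R (\<Sum>k\<in>{1..<n}. B (c k) (c (n - k)))"
          by (simp only: cn[OF n] B.scaleR_right right_inverse)
        then show ?thesis
          using n sym[of "c n" x] by (subst sum_atMost_split_ends) (auto simp: c0 scaleR_2[symmetric])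
      qed
      ultimately show ?thesis using c0 by (cases "n = 0") auto
    qed
    ultimately show ?thesis
      using sums_If_finite_set[of "{0}" "\<lambda>_. B x x"] by (simp add: sums_unique2)
  qed
  with rho c0 c1 sum show thesis by (intro that[of \<rho> c]) auto
qed

text \<open>The expansion at \<open>x\<close> is the real part of the Taylor series of the holomorphic extension.\<close>

lemma real_power_series_expansion_at:
  fixes a :: "nat \<Rightarrow> real"
  assumes "summable (\<lambda>n. \<bar>a n\<bar> * \<rho> ^ n)" and x: "\<bar>x\<bar> < \<rho>"
  obtains d where "\<And>y. \<bar>y - x\<bar> < \<rho> - \<bar>x\<bar> \<Longrightarrow> (\<lambda>n. (y - x) ^ n * d n) sums (\<Sum>n. y ^ n * a n)"
proof -
  define g where "g z = (\<Sum>n. complex_of_real (a n) * z ^ n)" for z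
  have sm: "summable (\<lambda>n. complex_of_real (a n) * z ^ n)" if "norm z < \<rho>" for z
  proof (rule summable_norm_cancel, rule summable_comparison_test[OF _ assms(1)])
    show "\<exists>N. \<forall>n\<ge>N. norm (norm (complex_of_real (a n) * z ^ n)) \<le> \<bar>a n\<bar> * \<rho> ^ n"
      using that by (auto simp: norm_mult norm_power intro!: exI[of _ 0] mult_left_mono power_mono)
  qed
  have "g holomorphic_on ball 0 \<rho>"
    by (rule power_series_holomorphic[where a = "\<lambda>n. complex_of_real (a n)"])
      (use sm in \<open>auto simp: g_def intro!: summable_sums\<close>)
  moreover have "ball (complex_of_real x) (\<rho> - \<bar>x\<bar>) \<subseteq> ball 0 \<rho>"
    by (rule ball_subset_ball_iff[THEN iffD2]) simp
  ultimately have hol: "g holomorphic_on ball (complex_of_real x) (\<rho> - \<bar>x\<bar>)"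
    by (rule holomorphic_on_subset)
  define d where "d n = Re ((deriv ^^ n) g x / fact n)" for n
  have "(\<lambda>n. (y - x) ^ n * d n) sums (\<Sum>n. y ^ n * a n)" if y: "\<bar>y - x\<bar> < \<rho> - \<bar>x\<bar>" for y
  proof -
    have "(\<lambda>n. (deriv ^^ n) g x / fact n * (of_real y - of_real x) ^ n) sums g y"
      using y by (intro holomorphic_power_series[OF hol])
        (simp add: dist_real_def abs_minus_commute)
    then have "(\<lambda>n. Re ((deriv ^^ n) g x / fact n * of_real ((y - x) ^ n))) sums Re (g y)"
      by (intro sums_Re) simp
    moreover have "Re ((deriv ^^ n) g x / fact n * of_real ((y - x) ^ n)) = (y - x) ^ n * d n" for n
    proof -
      have "Re (z * complex_of_real r) = r * Re z" for z r by simp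
      then show ?thesis unfolding d_def .
    qed
    moreover have "(\<lambda>n. complex_of_real (y ^ n * a n)) sums g y"
      using y summable_sums[OF sm[of y]] unfolding g_def by (simp add: mult.commute)
    then have "Re (g y) = (\<Sum>n. y ^ n * a n)"
      using sums_unique[OF sums_Re] by fastforce
    ultimately show ?thesis by simp
  qed
  then show thesis by (rule that)
qed

text \<open>Taking coordinates reduces this to real series. The same radius
  \<open>\<rho> - \<bar>x\<bar>\<close> serves every coordinate, so the expansions
  recombine.\<close>

lemma power_series_real_analytic_on:
  fixes c :: "nat \<Rightarrow> 'a::euclidean_space"
  assumes "summable (\<lambda>n. norm (c n) * \<rho> ^ n)" and "0 < \<rho>"
  shows "real_analytic_on (\<lambda>t. \<Sum>n. t ^ n *\<^sub>R c n) {0..<\<rho>}"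
  unfolding real_analytic_on_def
proof (intro ballI)
  fix x assume x: "x \<in> {0..<\<rho>}"
  have sm: "summable (\<lambda>n. \<bar>c n \<bullet> b\<bar> * \<rho> ^ n)" if "b \<in> Basis" for b
    by (rule summable_comparison_test[OF _ assms(1)])
      (use assms(2) that in \<open>auto intro!: exI[of _ 0] mult_right_mono Basis_le_norm\<close>)
  have "\<forall>b\<in>Basis. \<exists>d. \<forall>y. \<bar>y - x\<bar> < \<rho> - \<bar>x\<bar> \<longrightarrow> (\<lambda>n. (y - x) ^ n * d n) sums (\<Sum>n. y ^ n * (c n \<bullet> b))"
  proof
    fix b :: 'a assume "b \<in> Basis"
    from sm[OF this] show "\<exists>d. \<forall>y. \<bar>y - x\<bar> < \<rho> - \<bar>x\<bar> \<longrightarrow>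
        (\<lambda>n. (y - x) ^ n * d n) sums (\<Sum>n. y ^ n * (c n \<bullet> b))"
      using x by (elim real_power_series_expansion_at[where x = x]) auto
  qed
  from bchoice[OF this] obtain d where d: "\<And>b y. b \<in> Basis \<Longrightarrow> \<bar>y - x\<bar> < \<rho> - \<bar>x\<bar> \<Longrightarrow>
      (\<lambda>n. (y - x) ^ n * d b n) sums (\<Sum>n. y ^ n * (c n \<bullet> b))"
    by blast
  show "\<exists>r>0. \<exists>c'. \<forall>y\<in>{0..<\<rho>}. \<bar>y - x\<bar> < r \<longrightarrow> (\<lambda>n. (y - x) ^ n *\<^sub>R c' n) sums (\<Sum>n. y ^ n *\<^sub>R c n)"
  proof (intro exI[of _ "\<rho> - \<bar>x\<bar>"] exI[of _ "\<lambda>n. \<Sum>b\<in>Basis. d b n *\<^sub>R b"] conjI ballI impI)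
    show "0 < \<rho> - \<bar>x\<bar>" using x by simp
    fix y assume y: "y \<in> {0..<\<rho>}" "\<bar>y - x\<bar> < \<rho> - \<bar>x\<bar>"
    have "summable (\<lambda>n. y ^ n *\<^sub>R c n)"
      using y by (intro summable_norm_cancel[OF summable_norm_power_series[OF assms(1)]]) auto
    then have "(\<Sum>n. y ^ n *\<^sub>R c n) \<bullet> b = (\<Sum>n. y ^ n * (c n \<bullet> b))" for b
      using bounded_linear.suminf[OF bounded_linear_inner_left] by fastforce
    then have "(\<Sum>n. y ^ n *\<^sub>R c n) = (\<Sum>b\<in>Basis. (\<Sum>n. y ^ n * (c n \<bullet> b)) *\<^sub>R b)"
      using euclidean_representation[of "\<Sum>n. y ^ n *\<^sub>R c n"] by simp
    moreover have "(\<lambda>n. \<Sum>b\<in>Basis. ((y - x) ^ n * d b n) *\<^sub>R b) sums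
        (\<Sum>b\<in>Basis. (\<Sum>n. y ^ n * (c n \<bullet> b)) *\<^sub>R b)"
      by (intro sums_sum sums_scaleR_left d y(2))
    ultimately show "(\<lambda>n. (y - x) ^ n *\<^sub>R (\<Sum>b\<in>Basis. d b n *\<^sub>R b)) sums (\<Sum>n. y ^ n *\<^sub>R c n)"
      by (simp add: scaleR_sum_right)
  qed
qed

lemma real_analytic_on_bounded_linear:
  assumes "bounded_linear g" and "real_analytic_on f S"
  shows "real_analytic_on (\<lambda>t. g (f t)) S"
  unfolding real_analytic_on_def
proof
  interpret g: bounded_linear g by fact
  fix x assume "x \<in> S"
  then obtain r c where "0 < r"
    and c: "\<And>y. y \<in> S \<Longrightarrow> \<bar>y - x\<bar> < r \<Longrightarrow> (\<lambda>n. (y - x) ^ n *\<^sub>R c n) sums f y"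
    using bspec[OF assms(2)[unfolded real_analytic_on_def]] by blast
  have "(\<lambda>n. (y - x) ^ n *\<^sub>R g (c n)) sums g (f y)" if "y \<in> S" "\<bar>y - x\<bar> < r" for y
    using g.sums[OF c[OF that]] by (simp add: g.scaleR)
  with \<open>0 < r\<close> show "\<exists>r>0. \<exists>c. \<forall>y\<in>S. \<bar>y - x\<bar> < r \<longrightarrow>
      (\<lambda>n. (y - x) ^ n *\<^sub>R c n) sums g (f y)"
    by (intro exI[of _ r] conjI exI[of _ "\<lambda>n. g (c n)"]) auto
qed

section \<open>Power series as the argument tends to 0 from the right\<close>

lemma summable_norm_shifted:
  fixes c :: "nat \<Rightarrow> 'a::real_normed_vector"
  assumes "summable (\<lambda>n. norm (c n) * \<rho> ^ n)" "0 < \<rho>"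
  shows "summable (\<lambda>n. norm (c (Suc n)) * \<rho> ^ n)"
proof -
  have "summable (\<lambda>n. norm (c (Suc n)) * \<rho> ^ Suc n)"
    using assms(1) summable_Suc_iff[of "\<lambda>n. norm (c n) * \<rho> ^ n"] by simp
  from summable_mult[OF this, of "inverse \<rho>"] show ?thesis
    using assms(2) by (simp add: field_simps)
qed

lemma power_series_split_head:
  fixes c :: "nat \<Rightarrow> 'a::banach"
  assumes "summable (\<lambda>n. norm (c n) * \<rho> ^ n)" "0 < \<rho>" "\<bar>t\<bar> \<le> \<rho>"
  shows "(\<Sum>n. t ^ n *\<^sub>R c n) = c 0 + t *\<^sub>R (\<Sum>n. t ^ n *\<^sub>R c (Suc n))"
proof -
  have "summable (\<lambda>n. t ^ n *\<^sub>R c n)" "summable (\<lambda>n. t ^ n *\<^sub>R c (Suc n))"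
    using summable_norm_power_series[OF assms(1,3)]
      summable_norm_power_series[OF summable_norm_shifted[OF assms(1,2)] assms(3)]
    by (auto intro: summable_norm_cancel)
  then show ?thesis
    using suminf_split_head[of "\<lambda>n. t ^ n *\<^sub>R c n"] by (simp add: suminf_scaleR_right)
qed

lemma power_series_tendsto_at_right_0:
  fixes c :: "nat \<Rightarrow> 'a::banach"
  assumes c: "summable (\<lambda>n. norm (c n) * \<rho> ^ n)" and rho: "0 < \<rho>"
  shows "((\<lambda>t. \<Sum>n. t ^ n *\<^sub>R c n) \<longlongrightarrow> c 0) (at_right 0)"
proof -
  \<comment> \<open>\<open>C\<close> bounds, uniformly in \<open>t\<close>, the series left after
    removing \<open>c 0\<close> and one factor \<open>t\<close>.\<close>
  define C where "C = (\<Sum>n. norm (c (Suc n)) * \<rho> ^ n)"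
  have "\<forall>\<^sub>F t in at_right 0. norm ((\<Sum>n. t ^ n *\<^sub>R c n) - c 0) \<le> t * C"
    unfolding eventually_at_right_field
  proof (intro exI[of _ \<rho>] conjI rho allI impI)
    fix t :: real assume t: "0 < t" "t < \<rho>"
    then have t': "\<bar>t\<bar> \<le> \<rho>" by simp
    note sm = summable_norm_shifted[OF c rho]
    have "norm (\<Sum>n. t ^ n *\<^sub>R c (Suc n)) \<le> (\<Sum>n. norm (t ^ n *\<^sub>R c (Suc n)))"
      by (rule summable_norm[OF summable_norm_power_series[OF sm t']])
    also have "\<dots> \<le> C"
      unfolding C_def using t
      by (intro suminf_le summable_norm_power_series[OF sm t'] sm)
        (simp add: mult.commute mult_right_mono power_mono)
    finally show "norm ((\<Sum>n. t ^ n *\<^sub>R c n) - c 0) \<le> t * C"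
      using t power_series_split_head[OF c rho t'] by simp
  qed
  moreover have "((\<lambda>t. t * C) \<longlongrightarrow> 0) (at_right 0)"
    by (auto intro!: tendsto_eq_intros)
  ultimately have "((\<lambda>t. (\<Sum>n. t ^ n *\<^sub>R c n) - c 0) \<longlongrightarrow> 0) (at_right 0)"
    by (rule Lim_null_comparison)
  then show ?thesis by (simp add: LIM_zero_iff)
qed

text \<open>Serves to separate vertices at small positive times. If \<open>c 0\<close> vanishes,
  dividing by \<open>t\<close> leaves a series with limit \<open>c 1\<close>.\<close>

lemma power_series_eventually_nonzero:
  fixes c :: "nat \<Rightarrow> 'a::banach"
  assumes c: "summable (\<lambda>n. norm (c n) * \<rho> ^ n)" and rho: "0 < \<rho>"
    and "c 0 \<noteq> 0 \<or> c 1 \<noteq> 0"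
  shows "\<forall>\<^sub>F t in at_right 0. (\<Sum>n. t ^ n *\<^sub>R c n) \<noteq> 0"
proof (cases "c 0 = 0")
  case False
  then show ?thesis
    by (rule tendsto_imp_eventually_ne[OF power_series_tendsto_at_right_0[OF c rho]])
next
  case True
  with assms(3) have "c (Suc 0) \<noteq> 0" by simp
  then have "\<forall>\<^sub>F t in at_right 0. (\<Sum>n. t ^ n *\<^sub>R c (Suc n)) \<noteq> 0"
    by (rule tendsto_imp_eventually_ne
        [OF power_series_tendsto_at_right_0[OF summable_norm_shifted[OF c rho] rho]])
  moreover have "\<forall>\<^sub>F t in at_right 0. t \<in> {0<..<\<rho>}"
    using rho by (rule eventually_at_right_real)
  ultimately show ?thesis
  proof eventually_elim
    case (elim t)
    then show ?case using power_series_split_head[OF c rho, of t] True by simp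
  qed
qed

subsection \<open>The icosahedral graph and Gram matrices\<close>

lemma distinct_12: "distinct [1::12, 2, 3, 4, 5, 6, 7, 8, 9, 10, 11, 12]"
  by simp

lemma UNIV_12: "UNIV = {1::12, 2, 3, 4, 5, 6, 7, 8, 9, 10, 11, 12}"
proof -
  have "card (set [1::12, 2, 3, 4, 5, 6, 7, 8, 9, 10, 11, 12]) = CARD(12)"
    unfolding distinct_card[OF distinct_12] by simp
  then show ?thesis
    using card_eq_UNIV_imp_eq_UNIV[OF finite] unfolding list.set by blast
qed

lemma all_12: "(\<forall>i::12. P i) \<longleftrightarrow>
  P 1 \<and> P 2 \<and> P 3 \<and> P 4 \<and> P 5 \<and> P 6 \<and> P 7 \<and> P 8 \<and> P 9 \<and> P 10 \<and> P 11 \<and> P 12"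
proof -
  have "(\<forall>i. P i) \<longleftrightarrow> (\<forall>i\<in>UNIV. P i)" by simp
  then show ?thesis unfolding UNIV_12 by (simp only: ball_simps simp_thms)
qed

lemma sum_12:
  fixes f :: "12 \<Rightarrow> 'a::comm_monoid_add"
  shows "(\<Sum>i\<in>UNIV. f i) = sum_list (map f [1, 2, 3, 4, 5, 6, 7, 8, 9, 10, 11, 12])"
proof -
  have "UNIV = set [1::12, 2, 3, 4, 5, 6, 7, 8, 9, 10, 11, 12]"
    unfolding UNIV_12 list.set ..
  then show ?thesis using distinct_12 by (metis sum_list_distinct_conv_sum_set)
qed

text \<open>The 30 edges, smaller label first. An explicit list lets invariance under the generators
  be checked by evaluation.\<close>

definition edge_list :: "(12 \<times> 12) list" where
  "edge_list =
   [(1, 2), (1, 3), (1, 4), (1, 5), (1, 6), (2, 3), (2, 4), (2, 7),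
    (2, 8), (3, 6), (3, 7), (3, 11), (4, 5), (4, 8), (4, 9), (5, 6),
    (5, 9), (5, 10), (6, 10), (6, 11), (7, 8), (7, 11), (7, 12), (8, 9),
    (8, 12), (9, 10), (9, 12), (10, 11), (10, 12), (11, 12)]"

lemma bij_generators: "p \<in> {perm_a, perm_b, perm_c, perm_d} \<Longrightarrow> bij p"
  by (auto simp: perm_a_def perm_b_def perm_c_def perm_d_def intro!: bij_comp)

lemma perm_a_simps: 
  "perm_a 1 = 2"
  "perm_a 2 = 1"
  "perm_a 3 = 4"
  "perm_a 4 = 3"
  "perm_a 5 = 7"
  "perm_a 6 = 8"
  "perm_a 7 = 5"
  "perm_a 8 = 6"
  "perm_a 9 = 11"
  "perm_a 10 = 12"
  "perm_a 11 = 9"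
  "perm_a 12 = 10"
  by (simp_all add: perm_a_def Transposition.transpose_def)

lemma perm_b_simps: 
  "perm_b 1 = 10"
  "perm_b 2 = 12"
  "perm_b 3 = 9"
  "perm_b 4 = 11"
  "perm_b 5 = 6"
  "perm_b 6 = 5"
  "perm_b 7 = 8"
  "perm_b 8 = 7"
  "perm_b 9 = 3"
  "perm_b 10 = 1"
  "perm_b 11 = 4"
  "perm_b 12 = 2"
  by (simp_all add: perm_b_def Transposition.transpose_def)

lemma perm_c_simps: 
  "perm_c 1 = 7"
  "perm_c 2 = 3"
  "perm_c 3 = 2"
  "perm_c 4 = 11"
  "perm_c 5 = 12"
  "perm_c 6 = 8"
  "perm_c 7 = 1"
  "perm_c 8 = 6"
  "perm_c 9 = 10"
  "perm_c 10 = 9"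
  "perm_c 11 = 4"
  "perm_c 12 = 5"
  by (simp_all add: perm_c_def Transposition.transpose_def)

lemma perm_d_simps: 
  "perm_d 1 = 12"
  "perm_d 2 = 10"
  "perm_d 3 = 9"
  "perm_d 4 = 11"
  "perm_d 5 = 7"
  "perm_d 6 = 8"
  "perm_d 7 = 5"
  "perm_d 8 = 6"
  "perm_d 9 = 3"
  "perm_d 10 = 2"
  "perm_d 11 = 4"
  "perm_d 12 = 1"
  by (simp_all add: perm_d_def Transposition.transpose_def)

lemma generators_preserve_edge_list:
  assumes "p \<in> {perm_a, perm_b, perm_c, perm_d}"
  shows "(`) p ` (\<lambda>(i, j). {i, j}) ` set edge_list \<subseteq> (\<lambda>(i, j). {i, j}) ` set edge_list"
proof -
  have "\<forall>(i, j)\<in>set edge_list.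
      (perm_a i, perm_a j) \<in> set edge_list \<or> (perm_a j, perm_a i) \<in> set edge_list"
    by (simp add: edge_list_def perm_a_simps)
  moreover have "\<forall>(i, j)\<in>set edge_list.
      (perm_b i, perm_b j) \<in> set edge_list \<or> (perm_b j, perm_b i) \<in> set edge_list"
    by (simp add: edge_list_def perm_b_simps)
  moreover have "\<forall>(i, j)\<in>set edge_list.
      (perm_c i, perm_c j) \<in> set edge_list \<or> (perm_c j, perm_c i) \<in> set edge_list"
    by (simp add: edge_list_def perm_c_simps)
  moreover have "\<forall>(i, j)\<in>set edge_list.
      (perm_d i, perm_d j) \<in> set edge_list \<or> (perm_d j, perm_d i) \<in> set edge_list"
    by (simp add: edge_list_def perm_d_simps)
  ultimately have "\<forall>(i, j)\<in>set edge_list.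
      (p i, p j) \<in> set edge_list \<or> (p j, p i) \<in> set edge_list"
    using assms by blast
  then have edge: "(p i, p j) \<in> set edge_list \<or> (p j, p i) \<in> set edge_list"
    if "(i, j) \<in> set edge_list" for i j
    using that by blast
  show ?thesis
  proof (clarify)
    fix i j assume "(i, j) \<in> set edge_list"
    from edge[OF this] show "p ` {i, j} \<in> (\<lambda>(i, j). {i, j}) ` set edge_list"
    proof
      assume "(p i, p j) \<in> set edge_list"
      then show ?thesis by (intro image_eqI[of _ _ "(p i, p j)"]) auto
    next
      assume "(p j, p i) \<in> set edge_list"
      then show ?thesis by (intro image_eqI[of _ _ "(p j, p i)"]) auto
    qed
  qed
qed

text \<open>An injective map of a finite family into itself is onto, so generators preserve the
  family with equality, and hence so do their inverses. Carrying \<open>bij g\<close> along allows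
  products in \<open>BijGroup\<close> to be unfolded.\<close>

lemma icosahedral_group_preserves_edge_list:
  assumes "g \<in> icosahedral_group"
  shows "bij g \<and> (`) g ` (\<lambda>(i, j). {i, j}) ` set edge_list = (\<lambda>(i, j). {i, j}) ` set edge_list"
proof -
  let ?E = "(\<lambda>(i, j). {i, j}) ` set edge_list"
  have gen: "bij p \<and> (`) p ` ?E = ?E" if "p \<in> {perm_a, perm_b, perm_c, perm_d}" for p
  proof
    show "bij p" by (rule bij_generators[OF that])
    then have "inj_on ((`) p) ?E"
      by (meson bij_is_inj inj_image_eq_iff inj_onI)
    then show "(`) p ` ?E = ?E"
      by (intro endo_inj_surj generators_preserve_edge_list that) auto
  qed
  show ?thesis
    using assms unfolding icosahedral_group_def
  proof (induction g rule: generate.induct)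
    case one
    then show ?case using bij_id by (simp add: BijGroup_def restrict_def id_def)
  next
    case (incl h)
    then show ?case by (rule gen)
  next
    case (inv h)
    then have "bij h" and h: "(`) h ` ?E = ?E" using gen by auto
    then have "inv\<^bsub>BijGroup UNIV\<^esub> h = Hilbert_Choice.inv h"
      by (subst inv_BijGroup) (auto simp: Bij_def restrict_def)
    moreover have "(`) (Hilbert_Choice.inv h) ` (`) h ` ?E = ?E"
      using image_inv_f_f[OF bij_is_inj[OF \<open>bij h\<close>]]
      by (simp only: image_image[of "(`) (Hilbert_Choice.inv h)" "(`) h"] image_ident)
    ultimately show ?case using \<open>bij h\<close> h by (simp only: bij_imp_bij_inv)
  next
    case (eng g h)
    then have "g \<otimes>\<^bsub>BijGroup UNIV\<^esub> h = g \<circ> h"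
      by (auto simp: BijGroup_def Bij_def compose_def restrict_def)
    moreover have "(`) (g \<circ> h) ` ?E = (`) g ` (`) h ` ?E"
      by (simp add: image_comp comp_def image_image)
    ultimately show ?case using eng bij_comp[of h g] by (simp only: simp_thms)
  qed
qed

text \<open>This inclusion suffices: unit lengths on all listed pairs give unit lengths on all
  edges.\<close>

lemma edges_subset: "edges \<subseteq> (\<lambda>(i, j). {i, j}) ` set edge_list"
proof
  fix e assume "e \<in> edges"
  then obtain g where g: "g \<in> icosahedral_group" and e: "e = g ` {1, 2}"
    by (auto simp: edges_def)
  have "{1, 2} \<in> (\<lambda>(i, j). {i, j}) ` set edge_list"
    by (auto simp: edge_list_def)
  then show "e \<in> (\<lambda>(i, j). {i, j}) ` set edge_list"
    using icosahedral_group_preserves_edge_list[OF g] unfolding e by blast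
qed

section \<open>Gram matrices and isometry types\<close>

lemma gram_component: "gram M $ i $ j = column i M \<bullet> column j M"
  by (simp add: gram_def matrix_matrix_mult_def transpose_def column_def inner_vec_def)

lemma gram_action_component: "gram_action g G $ i $ j = G $ g i $ g j"
proof -
  have "gram_action g G $ i $ j =
      (\<Sum>k\<in>UNIV. (\<Sum>l\<in>UNIV. (if l = g i then 1 else 0) * G $ l $ k) * (if k = g j then 1 else 0))"
    by (simp add: gram_action_def matrix_matrix_mult_def transpose_def perm_matrix_def)
  also have "\<dots> = G $ g i $ g j"
    by (simp add: if_distrib[of "\<lambda>x. x * _"] if_distrib[of "\<lambda>x. _ * x"] cong: if_cong)
  finally show ?thesis .
qed

text \<open>A Gram matrix lies in its own orbit, and each orbit is finite because there are finitely
  many maps between labels.\<close>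

lemma finite_gram_if_finite_isometry_type:
  assumes "finite (isometry_type ` S)"
  shows "finite (gram ` S)"
proof -
  have "id \<in> icosahedral_group"
    using generate.one[of "BijGroup UNIV"] unfolding icosahedral_group_def
    by (simp add: BijGroup_def restrict_def id_def)
  moreover have "gram_action id G = G" for G
    by (simp add: vec_eq_iff gram_action_component)
  ultimately have "gram M \<in> isometry_type M" for M
    unfolding isometry_type_def by (metis image_eqI)
  then have "gram ` S \<subseteq> \<Union> (isometry_type ` S)" by blast
  moreover have "finite (isometry_type M)" for M
    by (simp add: isometry_type_def)
  ultimately show ?thesis
    using finite_Union[OF assms] by (elim finite_subset) auto
qed

section \<open>Twelve vertices from six points and a half-turn\<close>

type_synonym point = "real \<times> real \<times> real"
type_synonym config = "point \<times> point \<times> point \<times> point \<times> point \<times> point"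

definition half_turn :: "point \<Rightarrow> point" where
  "half_turn p = (- fst p, - fst (snd p), snd (snd p))"

lemma half_turn_half_turn [simp]: "half_turn (half_turn p) = p"
  by (simp add: half_turn_def)

lemma half_turn_add: "half_turn (p + q) = half_turn p + half_turn q"
  by (simp add: half_turn_def plus_prod_def)

lemma half_turn_scaleR: "half_turn (r *\<^sub>R p) = r *\<^sub>R half_turn p"
  by (simp add: half_turn_def scaleR_prod_def)

text \<open>The pairs are the cycles of \<open>perm_d\<close>, and the last branch is label 12, so
  \<open>perm_d\<close> acts as the half-turn by construction.\<close>

fun vertex :: "config \<Rightarrow> 12 \<Rightarrow> point" where
  "vertex (p1, p2, p3, p4, p5, p6) i =
    (if i = 1 then p1 else if i = 2 then p2 else if i = 3 then p3
     else if i = 4 then p4 else if i = 5 then p5 else if i = 6 then p6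
     else if i = 7 then half_turn p5 else if i = 8 then half_turn p6
     else if i = 9 then half_turn p3 else if i = 10 then half_turn p2
     else if i = 11 then half_turn p4 else half_turn p1)"

lemma vertex_values:
  "vertex (p1, p2, p3, p4, p5, p6) 1 = p1"
  "vertex (p1, p2, p3, p4, p5, p6) 2 = p2"
  "vertex (p1, p2, p3, p4, p5, p6) 3 = p3"
  "vertex (p1, p2, p3, p4, p5, p6) 4 = p4"
  "vertex (p1, p2, p3, p4, p5, p6) 5 = p5"
  "vertex (p1, p2, p3, p4, p5, p6) 6 = p6"
  "vertex (p1, p2, p3, p4, p5, p6) 7 = half_turn p5"
  "vertex (p1, p2, p3, p4, p5, p6) 8 = half_turn p6"
  "vertex (p1, p2, p3, p4, p5, p6) 9 = half_turn p3"
  "vertex (p1, p2, p3, p4, p5, p6) 10 = half_turn p2"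
  "vertex (p1, p2, p3, p4, p5, p6) 11 = half_turn p4"
  "vertex (p1, p2, p3, p4, p5, p6) 12 = half_turn p1"
  by simp_all

declare vertex.simps [simp del]

lemma vertex_add: "vertex (x + y) i = vertex x i + vertex y i"
  by (cases x rule: prod_cases6; cases y rule: prod_cases6)
    (simp add: vertex.simps half_turn_add)

lemma vertex_scaleR: "vertex (r *\<^sub>R x) i = r *\<^sub>R vertex x i"
  by (cases x rule: prod_cases6) (simp add: vertex.simps half_turn_scaleR)

lemma vertex_perm_d: "vertex x (perm_d i) = half_turn (vertex x i)"
proof -
  obtain p1 p2 p3 p4 p5 p6 where x: "x = (p1, p2, p3, p4, p5, p6)"
    by (cases x rule: prod_cases6)
  have "\<forall>i. vertex x (perm_d i) = half_turn (vertex x i)"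
    unfolding all_12 perm_d_simps x vertex_values by simp
  then show ?thesis by blast
qed

subsection \<open>Configurations invariant under a half-turn\<close>

text \<open>The polarisation of the squared distance: for fixed \<open>x\<close> it is half the
  derivative of that squared distance at \<open>x\<close>.\<close>

definition edge_form :: "12 \<Rightarrow> 12 \<Rightarrow> config \<Rightarrow> config \<Rightarrow> real" where
  "edge_form i j x y = (vertex x i - vertex x j) \<bullet> (vertex y i - vertex y j)"

lemma edge_form_commute: "edge_form i j x y = edge_form i j y x"
  by (simp add: edge_form_def inner_commute)

lemma edge_form_swap: "edge_form j i x y = edge_form i j x y"
  by (simp add: edge_form_def inner_diff)

lemma edge_form_perm_d: "edge_form (perm_d i) (perm_d j) x y = edge_form i j x y"
  by (simp add: edge_form_def vertex_perm_d half_turn_def inner_prod_def algebra_simps)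

lemma bounded_linear_vertex: "bounded_linear (\<lambda>x. vertex x i)"
  by (simp add: linear_conv_bounded_linear[symmetric] linear_iff vertex_add vertex_scaleR)

lemma bounded_bilinear_edge_form: "bounded_bilinear (edge_form i j)"
  unfolding bilinear_conv_bounded_bilinear[symmetric] bilinear_def linear_iff edge_form_def
  by (simp add: vertex_add vertex_scaleR inner_add inner_diff algebra_simps)

type_synonym lengths = "real \<times> real \<times> real \<times> real \<times> real \<times> real \<times> real \<times> real \<times>
  real \<times> real \<times> real \<times> real \<times> real \<times> real \<times> real"

text \<open>One edge from each of the 15 orbits of \<open>d\<close>.\<close>

definition rigidity_form :: "config \<Rightarrow> config \<Rightarrow> lengths" where
  "rigidity_form x y =
   (edge_form 1 2 x y, edge_form 1 3 x y, edge_form 1 4 x y, edge_form 1 5 x y,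
    edge_form 1 6 x y, edge_form 2 3 x y, edge_form 2 4 x y, edge_form 2 7 x y,
    edge_form 2 8 x y, edge_form 3 6 x y, edge_form 3 7 x y, edge_form 3 11 x y,
    edge_form 4 5 x y, edge_form 4 8 x y, edge_form 5 6 x y)"

lemma rigidity_form_commute: "rigidity_form x y = rigidity_form y x"
  unfolding rigidity_form_def by (intro arg_cong2[of _ _ _ _ Pair] edge_form_commute)

lemma bounded_bilinear_rigidity_form: "bounded_bilinear rigidity_form"
proof -
  have lin: "linear (edge_form i j x)" "linear (\<lambda>x. edge_form i j x y)" for i j x y
    using bounded_bilinear_edge_form
    by (blast intro: bounded_linear.linear bounded_bilinear.bounded_linear_left
        bounded_bilinear.bounded_linear_right)+
  show ?thesis
    unfolding bilinear_conv_bounded_bilinear[symmetric] bilinear_def linear_iff rigidity_form_def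
    by (simp add: lin[THEN linear_add] lin[THEN linear_scale])
qed

text \<open>Meant for \<open>u\<close> and \<open>w\<close> the square roots of 2 and 23. Vertex 3
  is the reflection of 5 in the plane through 1, 2, 6, and 4 is its mirror image in
  \<open>x = 0\<close>. Unit length of the edge from 3 to 11 gives 3 the second coordinate 1/2,
  hence 3/8 for the midpoint of 1 and 2. That midpoint has distance \<open>1 / sqrt 2\<close> from
  the origin, the midpoint of 5 and 6, which brings in the root of 23.\<close>

definition base_config :: "real \<Rightarrow> real \<Rightarrow> config" where
  "base_config u w =
    ((0, 3/8 + u * w / 16, w / 8 - 3 * u / 16), (0, 3/8 - u * w / 16, w / 8 + 3 * u / 16),
     (- 5/6, 1/2, w / 6), (5/6, 1/2, w / 6), (1/2, 0, 0), (- 1/2, 0, 0))"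

text \<open>Odd under the mirror in \<open>x = 0\<close>, and normalised by a rotation to have no
  second component at 5 and 6. Vertex 5 leaves 8 with relative velocity
  \<open>(2 * w, 0, - 4)\<close>, and 6 leaves 7 with \<open>(2 * w, 0, 4)\<close>.\<close>

definition base_flex :: "real \<Rightarrow> real \<Rightarrow> config" where
  "base_flex u w =
    ((3 * w / 2 - 3 * u / 4, 0, 0), (- 3 * w / 2 - 3 * u / 4, 0, 0),
     (- 5 * u / 6, 225 * u / 32, - 95 * (u * w) / 96),
     (- 5 * u / 6, - 225 * u / 32, 95 * (u * w) / 96), (w, 0, - 2), (w, 0, 2))"

lemma rigidity_form_base:
  assumes u: "u * u = 2" and w: "w * w = 23"
  shows "rigidity_form (base_config u w) (base_config u w) = (1, 1, 1, 1, 1, 1, 1, 1, 1, 1, 1, 1, 1, 1, 1)"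
    and "rigidity_form (base_config u w) (base_flex u w) = 0"
proof -
  have sq: "u\<^sup>2 = 2" "w\<^sup>2 = 23" "u * (u * z) = 2 * z" "w * (w * z) = 23 * z" for z :: real
    using u w by (simp_all add: power2_eq_square mult.assoc[symmetric])
  show "rigidity_form (base_config u w) (base_config u w) = (1, 1, 1, 1, 1, 1, 1, 1, 1, 1, 1, 1, 1, 1, 1)"
    by (simp add: rigidity_form_def edge_form_def base_config_def vertex_values half_turn_def
        inner_prod_def algebra_simps u w sq)
  show "rigidity_form (base_config u w) (base_flex u w) = 0"
    by (simp add: rigidity_form_def edge_form_def base_config_def base_flex_def vertex_values half_turn_def
        inner_prod_def algebra_simps u w sq zero_prod_def) (simp add: field_simps)
qed

text \<open>A proper range would have a nonzero normal vector \<open>a\<close>. Testing it on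
  displacements of one or two of the six points gives equilibrium equations that force all its
  coordinates to vanish.\<close>

lemma surj_rigidity_form_base:
  assumes u: "u * u = 2" and w: "w * w = 23"
  shows "surj (rigidity_form (base_config u w))"
proof (rule ccontr)
  let ?L = "rigidity_form (base_config u w)"
  assume "\<not> surj ?L"
  moreover have "linear ?L"
    using bounded_bilinear_rigidity_form
    by (blast intro: bounded_linear.linear bounded_bilinear.bounded_linear_right)
  then have "span (range ?L) = range ?L"
    by (simp add: linear_subspace_image subspace_UNIV span_eq_iff)
  ultimately obtain a where "a \<noteq> 0" and a: "\<And>y. a \<bullet> ?L y = 0"
    using span_not_UNIV_orthogonal[of "range ?L"] by blast
  obtain a12 a13 a14 a15 a16 a23 a24 a27 a28 a36 a37 a311 a45 a48 a56
    where a_def: "a = (a12, a13, a14, a15, a16, a23, a24, a27, a28, a36, a37, a311, a45, a48, a56)"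
    by (cases a) auto
  have sq: "u * (u * z) = 2 * z" "w * (w * z) = 23 * z" for z :: real
    using u w by (simp_all add: mult.assoc[symmetric])
  have sq_power: "u\<^sup>2 = 2" "w\<^sup>2 = 23" using u w by (simp_all add: power2_eq_square)
  have nz: "u \<noteq> 0" "w \<noteq> 0" using u w by auto
  note expand = a_def rigidity_form_def edge_form_def base_config_def vertex_values
    half_turn_def inner_prod_def
  \<comment> \<open>\<open>a\<close> is a self-stress. The vectors placed at vertex 3 (and, mirrored in the plane \<open>x = 0\<close>, at
    vertex 4) in \<open>t1\<close>, \<open>t2\<close> and \<open>t3\<close> are each orthogonal to two of the edges from 3 to 1, 2 and 6;
    \<open>(0, - w, 3)\<close> is parallel to the edge from 1 to 2, and \<open>(0, 3, w)\<close> to its perpendicular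
    bisector in the plane \<open>x = 0\<close>.\<close>
  have t1: "24 * u * (a13 - a14) = 0"
  proof -
    have "a \<bullet> ?L
        ((0, 0, 0), (0, 0, 0), (16 * u, 6 * w + 3 * u, u * w - 18), (16 * u, - (6 * w + 3 * u), 18 - u * w), (0, 0, 0), (0, 0, 0)) = 0"
      by (rule a)
    then show ?thesis using sq_power by (simp add: expand; algebra)
  qed
  have t2: "24 * u * (a23 - a24) = 0"
  proof -
    have "a \<bullet> ?L
        ((0, 0, 0), (0, 0, 0), (- (16 * u), 6 * w - 3 * u, - (u * w) - 18), (- (16 * u), 3 * u - 6 * w, u * w + 18), (0, 0, 0), (0, 0, 0)) = 0"
      by (rule a)
    then show ?thesis using sq_power by (simp add: expand; algebra)
  qed
  have t3: "a36 + a37 = a45 + a48"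
  proof -
    have "a \<bullet> ?L
        ((0, 0, 0), (0, 0, 0), (8, 15, 5 * w), (8, -15, - (5 * w)), (0, 0, 0), (0, 0, 0)) = 0"
      by (rule a)
    then show ?thesis using sq_power by (simp add: expand; algebra)
  qed
  have t4: "5 * (a13 - a14) = 3 * (a15 - a16)"
  proof -
    have "a \<bullet> ?L
        ((1, 0, 0), (0, 0, 0), (0, 0, 0), (0, 0, 0), (0, 0, 0), (0, 0, 0)) = 0"
      by (rule a)
    then show ?thesis using sq_power by (simp add: expand; algebra)
  qed
  have t5: "5 * (a23 - a24) = 3 * (a28 - a27)"
  proof -
    have "a \<bullet> ?L
        ((0, 0, 0), (1, 0, 0), (0, 0, 0), (0, 0, 0), (0, 0, 0), (0, 0, 0)) = 0"
      by (rule a)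
    then show ?thesis using sq_power by (simp add: expand; algebra)
  qed
  have t6: "2 * u * (2 * a12 + a13 + a14 + a15 + a16) = 0"
  proof -
    have "a \<bullet> ?L
        ((0, - w, 3), (0, 0, 0), (0, 0, 0), (0, 0, 0), (0, 0, 0), (0, 0, 0)) = 0"
      by (rule a)
    then show ?thesis using sq_power by (simp add: expand; algebra)
  qed
  have t7: "a13 + a14 = 3 * (a15 + a16)"
  proof -
    have "a \<bullet> ?L
        ((0, 3, w), (0, 0, 0), (0, 0, 0), (0, 0, 0), (0, 0, 0), (0, 0, 0)) = 0"
      by (rule a)
    then show ?thesis using sq_power by (simp add: expand; algebra)
  qed
  have t8: "2 * u * (2 * a12 + a23 + a24 + a27 + a28) = 0"
  proof -
    have "a \<bullet> ?L
        ((0, 0, 0), (0, - w, 3), (0, 0, 0), (0, 0, 0), (0, 0, 0), (0, 0, 0)) = 0"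
      by (rule a)
    then show ?thesis using sq_power by (simp add: expand; algebra)
  qed
  have t9: "a23 + a24 = 3 * (a27 + a28)"
  proof -
    have "a \<bullet> ?L
        ((0, 0, 0), (0, 3, w), (0, 0, 0), (0, 0, 0), (0, 0, 0), (0, 0, 0)) = 0"
      by (rule a)
    then show ?thesis using sq_power by (simp add: expand; algebra)
  qed
  \<comment> \<open>In \<open>t10\<close> to \<open>t13\<close> vertex 3 moves alone, so
    \<open>a311\<close> remains; in \<open>t1\<close> to \<open>t3\<close> the motion of vertex 4
    cancelled the contribution of the edge from 3 to 11.\<close>
  have t10: "2 * u * (a13 - a23) = w * a311"
  proof -
    have "a \<bullet> ?L
        ((0, 0, 0), (0, 0, 0), (0, - w, 3), (0, 0, 0), (0, 0, 0), (0, 0, 0)) = 0"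
      by (rule a)
    then show ?thesis by (simp add: expand algebra_simps u w sq; linarith)
  qed
  have t11: "24 * u * a13 = (6 * w + 3 * u) * a311"
  proof -
    have "a \<bullet> ?L
        ((0, 0, 0), (0, 0, 0), (16 * u, 6 * w + 3 * u, u * w - 18), (0, 0, 0), (0, 0, 0), (0, 0, 0)) = 0"
      by (rule a)
    then show ?thesis using sq_power by (simp add: expand; algebra)
  qed
  have t12: "24 * u * a23 + (6 * w - 3 * u) * a311 = 0"
  proof -
    have "a \<bullet> ?L
        ((0, 0, 0), (0, 0, 0), (- (16 * u), 6 * w - 3 * u, - (u * w) - 18), (0, 0, 0), (0, 0, 0), (0, 0, 0)) = 0"
      by (rule a)
    then show ?thesis using sq_power by (simp add: expand; algebra)
  qed
  have t13: "24 * (a36 + a37) + 15 * a311 = 0"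
  proof -
    have "a \<bullet> ?L
        ((0, 0, 0), (0, 0, 0), (8, 15, 5 * w), (0, 0, 0), (0, 0, 0), (0, 0, 0)) = 0"
      by (rule a)
    then show ?thesis using sq_power by (simp add: expand; algebra)
  qed
  have a13: "a13 = a14" and a23: "a23 = a24" using t1 t2 nz by auto
  have a15: "a15 = a16" and a27: "a27 = a28" using t4 t5 a13 a23 by auto
  have "a12 = - (a13 + a14 + a15 + a16) / 2" "a12 = - (a23 + a24 + a27 + a28) / 2"
    using t6 t8 nz by auto
  \<comment> \<open>By \<open>t7\<close> and \<open>t9\<close> the two expressions for
    \<open>a12\<close> are \<open>- 4/3\<close> times \<open>a13\<close> and
    \<open>a23\<close>.\<close>
  then have "a13 = a23" using t7 t9 a13 a15 a23 a27 by simp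
  then have a311: "a311 = 0" using t10 nz by simp
  then have z1: "a13 = 0" "a23 = 0" "a36 + a37 = 0" using t11 t12 t13 nz by auto
  then have z2: "a14 = 0" "a24 = 0" "a15 = 0" "a16 = 0" "a27 = 0" "a28 = 0" "a12 = 0"
    using a13 a23 a15 a27 t7 t9 t6 nz by auto
  \<comment> \<open>Moving 5 also moves 7, so \<open>a37\<close> and \<open>a45\<close> both enter:
    with opposite signs in the second direction, with equal signs in the third.\<close>
  have t14: "a37 = a45"
  proof -
    have "a \<bullet> ?L
        ((0, 0, 0), (0, 0, 0), (0, 0, 0), (0, 0, 0), (0, 1, 0), (0, 0, 0)) = 0"
      by (rule a)
    then show ?thesis using sq_power a311 z1 z2 by (simp add: expand; algebra)
  qed
  have t15: "w * (a37 + a45) = 0"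
  proof -
    have "a \<bullet> ?L
        ((0, 0, 0), (0, 0, 0), (0, 0, 0), (0, 0, 0), (0, 0, 1), (0, 0, 0)) = 0"
      by (rule a)
    then show ?thesis using sq_power a311 z1 z2 by (simp add: expand; algebra)
  qed
  have t16: "a56 = (a37 + a45) / 3"
  proof -
    have "a \<bullet> ?L
        ((0, 0, 0), (0, 0, 0), (0, 0, 0), (0, 0, 0), (1, 0, 0), (0, 0, 0)) = 0"
      by (rule a)
    then show ?thesis using sq_power a311 z1 z2 by (simp add: expand; algebra)
  qed
  have "a37 = 0" "a45 = 0" using t14 t15 nz by auto
  then have "a = 0" using z1 z2 a311 t3 t16 by (simp add: a_def zero_prod_def)
  with \<open>a \<noteq> 0\<close> show False ..
qed

section \<open>Coordinate matrices of symmetric configurations\<close>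

definition coordinate_matrix :: "config \<Rightarrow> real^12^3" where
  "coordinate_matrix x = (\<chi> r i.
    if r = 1 then fst (vertex x i) else if r = 2 then fst (snd (vertex x i))
    else snd (snd (vertex x i)) - (\<Sum>j\<in>UNIV. snd (snd (vertex x j))) / 12)"

lemma bounded_linear_coordinate_matrix: "bounded_linear coordinate_matrix"
proof (rule linear_conv_bounded_linear[THEN iffD1], rule linearI)
  fix x y :: config and r :: real
  show "coordinate_matrix (x + y) = coordinate_matrix x + coordinate_matrix y"
    by (simp add: coordinate_matrix_def vec_eq_iff vertex_add sum.distrib add_divide_distrib)
  show "coordinate_matrix (r *\<^sub>R x) = r *\<^sub>R coordinate_matrix x"
    by (simp add: coordinate_matrix_def vec_eq_iff vertex_scaleR sum_distrib_left[symmetric]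
        right_diff_distrib)
qed

lemma norm_column_diff_coordinate_matrix:
  "(norm (column i (coordinate_matrix x) - column j (coordinate_matrix x)))\<^sup>2 = edge_form i j x x"
  by (simp add: power2_norm_eq_inner inner_vec_def sum_3 column_def coordinate_matrix_def
      edge_form_def inner_prod_def)

lemma column_coordinate_matrix_eq_iff:
  "column i (coordinate_matrix x) = column j (coordinate_matrix x) \<longleftrightarrow> vertex x i = vertex x j"
proof -
  have "column i (coordinate_matrix x) = column j (coordinate_matrix x) \<longleftrightarrow> edge_form i j x x = 0"
    by (simp add: norm_column_diff_coordinate_matrix[symmetric])
  then show ?thesis by (simp add: edge_form_def)
qed

text \<open>The 15 representatives and their images under \<open>perm_d\<close> exhaust the edge
  list up to the order of endpoints.\<close>

lemma edge_form_eq_1: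
  assumes "rigidity_form x x = (1, 1, 1, 1, 1, 1, 1, 1, 1, 1, 1, 1, 1, 1, 1)"
    and "(i, j) \<in> set edge_list"
  shows "edge_form i j x x = 1"
proof -
  have "\<forall>(i, j) \<in> {(1, 2), (1, 3), (1, 4), (1, 5), (1, 6), (2, 3), (2, 4), (2, 7), (2, 8), (3, 6),
      (3, 7), (3, 11), (4, 5), (4, 8), (5, 6)}. edge_form i j x x = 1"
    using assms(1) by (simp add: rigidity_form_def)
  moreover from this have "\<forall>(i, j) \<in> {(1, 2), (1, 3), (1, 4), (1, 5), (1, 6), (2, 3), (2, 4), (2, 7), (2, 8), (3, 6),
      (3, 7), (3, 11), (4, 5), (4, 8), (5, 6)}. edge_form (perm_d i) (perm_d j) x x = 1"
    unfolding edge_form_perm_d .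
  ultimately have "\<forall>(i, j) \<in> set edge_list. edge_form i j x x = 1 \<or> edge_form j i x x = 1"
    by (simp add: edge_list_def perm_d_simps)
  with assms(2) show ?thesis using edge_form_swap by auto
qed

lemma d_invariant_icosahedron_coordinate_matrix:
  assumes rigidity: "rigidity_form x x = (1, 1, 1, 1, 1, 1, 1, 1, 1, 1, 1, 1, 1, 1, 1)"
    and inj: "inj (vertex x)"
  shows "d_invariant_icosahedron (coordinate_matrix x)"
proof -
  let ?M = "coordinate_matrix x"
  have "inj (\<lambda>i. column i ?M)"
    using inj by (simp add: inj_def column_coordinate_matrix_eq_iff)
  moreover have "norm (column i ?M - column j ?M) = 1" if "{i, j} \<in> edges" for i j
  proof -
    obtain k l where kl: "(k, l) \<in> set edge_list" "{i, j} = {k, l}"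
      using \<open>{i, j} \<in> edges\<close> edges_subset by auto
    then have "edge_form i j x x = 1"
      using edge_form_eq_1[OF rigidity] edge_form_swap by (metis doubleton_eq_iff)
    then have "(norm (column i ?M - column j ?M))\<^sup>2 = 1"
      by (simp add: norm_column_diff_coordinate_matrix)
    then show ?thesis by (simp add: power2_eq_1_iff) (smt (verit) norm_ge_zero)
  qed
  \<comment> \<open>The first two coordinates cancel within each orbit of the half-turn; the third
    is recentred by \<open>coordinate_matrix\<close>, a translation along the axis.\<close>
  moreover have "(\<Sum>i\<in>UNIV. column i ?M) = 0"
  proof -
    obtain p1 p2 p3 p4 p5 p6 where x: "x = (p1, p2, p3, p4, p5, p6)"
      by (cases x rule: prod_cases6)
    have "(\<Sum>i\<in>UNIV. fst (vertex x i)) = 0" "(\<Sum>i\<in>UNIV. fst (snd (vertex x i))) = 0"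
      unfolding sum_12 x list.map vertex_values by (simp_all add: half_turn_def)
    then show ?thesis
      by (simp add: vec_eq_iff forall_3 column_def coordinate_matrix_def sum_subtractf)
  qed
  \<comment> \<open>The half-turn preserves inner products and commutes with translation along its
    axis.\<close>
  moreover have "gram_action perm_d (gram ?M) = gram ?M"
    by (simp add: vec_eq_iff gram_action_component gram_component inner_vec_def sum_3
        column_def coordinate_matrix_def vertex_perm_d half_turn_def)
  ultimately show ?thesis
    by (simp add: d_invariant_icosahedron_def is_icosahedron_def)
qed

text \<open>In the base configuration only 5 meets 8 and 6 meets 7, and the flex parts both
  pairs.\<close>

lemma base_vertices_separated:
  assumes u: "u * u = 2" and w: "w * w = 23" and "i \<noteq> j"
  shows "vertex (base_config u w) i \<noteq> vertex (base_config u w) j \<or>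
    vertex (base_flex u w) i \<noteq> vertex (base_flex u w) j"
proof -
  have nz: "u \<noteq> 0" "w \<noteq> 0" using u w by auto
  have "(u * w) * (u * w) = 46" using u w by (metis mult.assoc mult.left_commute mult_numeral_1_right numeral_times_numeral semiring_norm)
  \<comment> \<open>These values would put vertex 2 or 1 of the base configuration on the axis,
    where it equals its image under the half-turn.\<close>
  then have uw: "u * w \<noteq> 6" "u * w \<noteq> - 6" by auto
  have "\<forall>i j. i \<noteq> j \<longrightarrow> vertex (base_config u w) i \<noteq> vertex (base_config u w) j \<or>
    vertex (base_flex u w) i \<noteq> vertex (base_flex u w) j"
    unfolding all_12 base_config_def base_flex_def vertex_values half_turn_def
    using nz uw by auto
  with \<open>i \<noteq> j\<close> show ?thesis by blast
qed

section \<open>The curve of icosahedra and its isometry types\<close>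

lemma tendsto_edge_form:
  assumes "(f \<longlongrightarrow> x) F"
  shows "((\<lambda>t. edge_form i j (f t) (f t)) \<longlongrightarrow> edge_form i j x x) F"
  by (rule bounded_bilinear.tendsto[OF bounded_bilinear_edge_form assms assms])

lemma edge_form_gram:
  "gram (coordinate_matrix x) $ i $ i - 2 * gram (coordinate_matrix x) $ i $ j +
    gram (coordinate_matrix x) $ j $ j = edge_form i j x x"
  by (simp add: norm_column_diff_coordinate_matrix[symmetric] gram_component
      power2_norm_eq_inner inner_diff inner_commute)

text \<open>The coincidence at time 0 is recorded because it later yields both non-constancy and
  infinitely many lengths.\<close>

lemma flexible_configurations:
  obtains \<epsilon> c where "0 < \<epsilon>" "summable (\<lambda>n. norm (c n) * \<epsilon> ^ n)"
    "\<forall>t\<in>{0<..<\<epsilon>}. d_invariant_icosahedron (coordinate_matrix (\<Sum>n. t ^ n *\<^sub>R c n))"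
    "vertex (c 0) 5 = vertex (c 0) 8"
proof -
  define u w :: real where "u = sqrt 2" and "w = sqrt 23"
  have u: "u * u = 2" and w: "w * w = 23" by (simp_all add: u_def w_def)
  have "linear (rigidity_form (base_config u w))"
    using bounded_bilinear_rigidity_form
    by (blast intro: bounded_linear.linear bounded_bilinear.bounded_linear_right)
  then obtain h where "linear h" and h: "rigidity_form (base_config u w) \<circ> h = id"
    using linear_surjective_right_inverse surj_rigidity_form_base[OF u w] by blast
  have "bounded_linear h"
    using \<open>linear h\<close> by (simp only: linear_conv_bounded_linear)
  moreover have "rigidity_form (base_config u w) (h y) = y" for y
    using h by (metis comp_apply id_apply)
  ultimately obtain c and \<rho> :: real where rho: "0 < \<rho>" and c0: "c 0 = base_config u w" and c1: "c 1 = base_flex u w"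
    and c: "summable (\<lambda>n. norm (c n) * \<rho> ^ n)"
    and curve: "\<forall>t. \<bar>t\<bar> \<le> \<rho> \<longrightarrow> rigidity_form (\<Sum>n. t ^ n *\<^sub>R c n) (\<Sum>n. t ^ n *\<^sub>R c n) =
      rigidity_form (base_config u w) (base_config u w)"
    by (rule quadric_curve[OF bounded_bilinear_rigidity_form rigidity_form_commute _ _
        rigidity_form_base(2)[OF u w]])
  have "\<forall>\<^sub>F t in at_right 0. vertex (\<Sum>n. t ^ n *\<^sub>R c n) i \<noteq> vertex (\<Sum>n. t ^ n *\<^sub>R c n) j"
    if "i \<noteq> j" for i j
  proof -
    \<comment> \<open>The difference of two vertices is linear in the configuration, hence a power
      series along the curve, with a nonzero coefficient of order 0 or 1.\<close>
    define l where "l x = vertex x i - vertex x j" for x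
    have l: "bounded_linear l"
      unfolding l_def by (intro bounded_linear_sub bounded_linear_vertex)
    obtain K where K: "\<And>x. norm (l x) \<le> norm x * K"
      using bounded_linear.bounded[OF l] by blast
    have "summable (\<lambda>n. norm (l (c n)) * \<rho> ^ n)"
    proof (rule summable_comparison_test[OF _ summable_mult[OF c, of K]], intro exI allI impI)
      fix n
      show "norm (norm (l (c n)) * \<rho> ^ n) \<le> K * (norm (c n) * \<rho> ^ n)"
        using mult_right_mono[OF K, of "\<rho> ^ n" "c n"] rho by (simp add: mult_ac)
    qed
    moreover have "l (c 0) \<noteq> 0 \<or> l (c 1) \<noteq> 0"
      using base_vertices_separated[OF u w that] by (simp add: l_def c0 c1[simplified])
    ultimately have "\<forall>\<^sub>F t in at_right 0. (\<Sum>n. t ^ n *\<^sub>R l (c n)) \<noteq> 0"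
      by (intro power_series_eventually_nonzero[OF _ rho])
    moreover have "\<forall>\<^sub>F t in at_right 0. t \<in> {0<..<\<rho>}"
      using rho by (rule eventually_at_right_real)
    ultimately show ?thesis
    proof eventually_elim
      case (elim t)
      have "summable (\<lambda>n. t ^ n *\<^sub>R c n)"
        using elim by (intro summable_norm_cancel[OF summable_norm_power_series[OF c]]) auto
      then have "l (\<Sum>n. t ^ n *\<^sub>R c n) = (\<Sum>n. t ^ n *\<^sub>R l (c n))"
        using bounded_linear.suminf[OF l] bounded_linear.linear[OF l]
        by (simp add: linear_scale)
      then show ?case using elim by (auto simp: l_def)
    qed
  qed
  then have "\<forall>\<^sub>F t in at_right 0. \<forall>i j. i \<noteq> j \<longrightarrow>
      vertex (\<Sum>n. t ^ n *\<^sub>R c n) i \<noteq> vertex (\<Sum>n. t ^ n *\<^sub>R c n) j"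
    by (intro eventually_all_finite) (simp add: eventually_mono)
  then obtain b where b: "0 < b" and inj: "\<And>t. t \<in> {0<..<b} \<Longrightarrow> inj (vertex (\<Sum>n. t ^ n *\<^sub>R c n))"
    unfolding eventually_at_right_field inj_def by auto
  show thesis
  proof (rule that[of "min b \<rho>" c])
    show "0 < min b \<rho>" using b rho by simp
    show "summable (\<lambda>n. norm (c n) * min b \<rho> ^ n)"
    proof (rule summable_comparison_test[OF _ c], intro exI allI impI)
      fix n
      show "norm (norm (c n) * min b \<rho> ^ n) \<le> norm (c n) * \<rho> ^ n"
        using b rho by (simp add: mult_left_mono power_mono)
    qed
    show "\<forall>t\<in>{0<..<min b \<rho>}. d_invariant_icosahedron (coordinate_matrix (\<Sum>n. t ^ n *\<^sub>R c n))"
      using curve inj rigidity_form_base(1)[OF u w]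
      by (intro ballI d_invariant_icosahedron_coordinate_matrix) auto
    show "vertex (c 0) 5 = vertex (c 0) 8"
      unfolding c0 base_config_def vertex_values by (simp add: half_turn_def)
  qed
qed

theorem proposition21:
  shows "(\<exists>\<epsilon>>0. \<exists>\<Phi> :: real \<Rightarrow> real^12^3.
      real_analytic_on \<Phi> {0..<\<epsilon>} \<and>
      \<not> \<Phi> constant_on {0..<\<epsilon>} \<and>
      finite {t \<in> {0..<\<epsilon>}. \<not> d_invariant_icosahedron (\<Phi> t)}) \<and>
    infinite (isometry_type ` {M. d_invariant_icosahedron M})"
proof -
  obtain \<epsilon> and c :: "nat \<Rightarrow> config" where eps: "0 < \<epsilon>" and c: "summable (\<lambda>n. norm (c n) * \<epsilon> ^ n)"
    and ico: "\<forall>t\<in>{0<..<\<epsilon>}. d_invariant_icosahedron (coordinate_matrix (\<Sum>n. t ^ n *\<^sub>R c n))"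
    and deg: "vertex (c 0) 5 = vertex (c 0) 8"
    by (rule flexible_configurations)
  define f where "f t = (\<Sum>n. t ^ n *\<^sub>R c n)" for t
  have f0: "f 0 = c 0" using power_series_split_head[OF c eps, of 0] eps by (simp add: f_def)
  have separated: "vertex (f t) 5 \<noteq> vertex (f t) 8" if "t \<in> {0<..<\<epsilon>}" for t
  proof -
    have "inj (\<lambda>i. column i (coordinate_matrix (f t)))"
      using bspec[OF ico that] by (simp add: d_invariant_icosahedron_def is_icosahedron_def f_def)
    then have "column 5 (coordinate_matrix (f t)) \<noteq> column 8 (coordinate_matrix (f t))"
      by (auto dest: injD)
    then show ?thesis by (simp add: column_coordinate_matrix_eq_iff)
  qed
  have "real_analytic_on (\<lambda>t. coordinate_matrix (f t)) {0..<\<epsilon>}"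
  proof -
    have "real_analytic_on f {0..<\<epsilon>}"
      unfolding f_def by (rule power_series_real_analytic_on[OF c eps])
    then show ?thesis
      by (rule real_analytic_on_bounded_linear[OF bounded_linear_coordinate_matrix])
  qed
  moreover have "\<not> (\<lambda>t. coordinate_matrix (f t)) constant_on {0..<\<epsilon>}"
  proof
    assume "(\<lambda>t. coordinate_matrix (f t)) constant_on {0..<\<epsilon>}"
    then have "coordinate_matrix (f (\<epsilon> / 2)) = coordinate_matrix (f 0)"
      using eps unfolding constant_on_def by force
    then have "vertex (f (\<epsilon> / 2)) 5 = vertex (f (\<epsilon> / 2)) 8"
      using deg f0 by (metis column_coordinate_matrix_eq_iff)
    then show False using separated[of "\<epsilon> / 2"] eps by simp
  qed
  moreover have "finite {t \<in> {0..<\<epsilon>}. \<not> d_invariant_icosahedron (coordinate_matrix (f t))}"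
  proof (rule finite_subset)
    show "{t \<in> {0..<\<epsilon>}. \<not> d_invariant_icosahedron (coordinate_matrix (f t))} \<subseteq> {0}"
      using ico unfolding f_def by force
  qed simp
  moreover have "infinite (isometry_type ` {M. d_invariant_icosahedron M})"
  proof
    assume "finite (isometry_type ` {M. d_invariant_icosahedron M})"
    then have fin: "finite (gram ` {M. d_invariant_icosahedron M})"
      by (rule finite_gram_if_finite_isometry_type)
    \<comment> \<open>The element 1 keeps \<open>D\<close> nonempty, so \<open>Min D\<close> is
      meaningful; keeping only positive values makes it positive.\<close>
    define D where "D = insert 1 ((\<lambda>G. G $ 5 $ 5 - 2 * G $ 5 $ 8 + G $ 8 $ 8) `
      gram ` {M. d_invariant_icosahedron M} \<inter> {0<..})"
    have D: "finite D" "D \<noteq> {}" "\<And>r. r \<in> D \<Longrightarrow> 0 < r"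
      using fin by (auto simp: D_def)
    have in_D: "edge_form 5 8 (f t) (f t) \<in> D" if "t \<in> {0<..<\<epsilon>}" for t
    proof -
      have "0 < edge_form 5 8 (f t) (f t)"
        using separated[OF that] by (simp add: edge_form_def)
      moreover have "edge_form 5 8 (f t) (f t) \<in>
          (\<lambda>G. G $ 5 $ 5 - 2 * G $ 5 $ 8 + G $ 8 $ 8) ` gram ` {M. d_invariant_icosahedron M}"
        using bspec[OF ico that] edge_form_gram[of "f t" 5 8, symmetric] unfolding f_def by blast
      ultimately show ?thesis by (simp add: D_def)
    qed
    have "((\<lambda>t. edge_form 5 8 (f t) (f t)) \<longlongrightarrow> edge_form 5 8 (c 0) (c 0)) (at_right 0)"
      unfolding f_def by (intro tendsto_edge_form power_series_tendsto_at_right_0[OF c eps])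
    then have "((\<lambda>t. edge_form 5 8 (f t) (f t)) \<longlongrightarrow> 0) (at_right 0)"
      by (simp add: edge_form_def deg)
    moreover have "0 < Min D" using D by simp
    ultimately have "\<forall>\<^sub>F t in at_right 0. edge_form 5 8 (f t) (f t) < Min D"
      by (rule order_tendstoD)
    moreover have "\<forall>\<^sub>F t in at_right 0. t \<in> {0<..<\<epsilon>}"
      using eps by (rule eventually_at_right_real)
    ultimately have "\<forall>\<^sub>F t in at_right (0::real). False"
    proof eventually_elim
      case (elim t)
      then show ?case using Min_le[OF D(1) in_D[of t]] by simp
    qed
    then show False by simp
  qed
  ultimately show ?thesis using eps by blast
qed

end
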